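(* Let $n \ge 1$ be an integer, let $x_1 < x_2 < \cdots < x_{n+1}$ be real numbers, write $\mathbf{x} = (x_1,\ldots,x_{n+1})$, and let $R(\mathbf{x}) := [x_1,x_2]\times[x_2,x_3]\times\cdots\times[x_n,x_{n+1}]\subset\mathbb{R}^n$. Then $$\int_{R(\mathbf{x})} V(\mathbf{t})\, d\mathbf{t} = \frac{1}{n!}\, V(\mathbf{x}).$$
   Context: For any integer $m \ge 1$ and $\mathbf{t}=(t_1,\ldots,t_m)\in\mathbb{R}^m$, the Vandermonde polynomial is $V(\mathbf{t}) = V(t_1,\ldots,t_m) := \prod_{1\le i<j\le m}(t_j-t_i)$ (the empty product is $1$). In the claim, $V(\mathbf{t})$ has $n$ variables $\mathbf{t}=(t_1,\ldots,t_n)$ and $V(\mathbf{x})$ has $n+1$ variables. The integral is $\int_{R(\mathbf{x})}\phi(\mathbf{t})\,d\mathbf{t} := \int_{x_n}^{x_{n+1}}\cdots\int_{x_2}^{x_3}\int_{x_1}^{x_2}\phi(t_1,\ldots,t_n)\,dt_1\,dt_2\cdots dt_n$. *)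

theory Defs
  imports "HOL-Analysis.Analysis"
begin

(* A vector (t_1, ..., t_m) is a function t :: nat => real, of which only the
   values t 1, ..., t m matter. *)

definition vandermonde :: "nat \<Rightarrow> (nat \<Rightarrow> real) \<Rightarrow> real" where
  "vandermonde m t = (\<Prod>(i, j)\<in>{(i, j). 1 \<le> i \<and> i < j \<and> j \<le> m}. t j - t i)"

(* interlacing_integral n x phi is the integral of phi(t_1, ..., t_n) over the box
   R(x) = [x_1, x_2] \<times> ... \<times> [x_n, x_(n+1)], as the iterated integral in which t_1 is
   the innermost variable and t_n the outermost. The recursion peels off the outermost
   one, fixing its value in the integrand. The value 0 in the base case fills the
   coordinates outside {1..n}, on which phi should not depend. *)
primrec interlacing_integral ::
  "nat \<Rightarrow> (nat \<Rightarrow> real) \<Rightarrow> ((nat \<Rightarrow> real) \<Rightarrow> real) \<Rightarrow> real" where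
  "interlacing_integral 0 x \<phi> = \<phi> (\<lambda>_. 0)"
| "interlacing_integral (Suc n) x \<phi> =
     integral {x (Suc n)..x (Suc (Suc n))}
       (\<lambda>s. interlacing_integral n x (\<lambda>t. \<phi> (t(Suc n := s))))"

end

theory Submission
  imports Defs "Jordan_Normal_Form.Determinant"
begin

text \<open>
  The Vandermonde polynomial is the determinant of the matrix of powers
  \<open>t\<^sub>i\<^sup>j\<close>, so it is a signed sum of products in which each variable occurs in exactly
  one factor (\<open>vandermonde_eq_det\<close>, \<open>det_mat_leibniz\<close>). Integration over a box is
  multilinear in such products (\<open>interlacing_integral_sum_prod\<close>), hence it can be
  carried out entry by entry: the integral is the determinant of the matrix with entries
  \<open>(x\<^sub>i\<^sub>+\<^sub>1\<^sup>j\<^sup>+\<^sup>1 - x\<^sub>i\<^sup>j\<^sup>+\<^sup>1) / (j + 1)\<close> for \<open>1 \<le> i \<le> n\<close> and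
  \<open>0 \<le> j < n\<close>.

  The denominators come out of the columns as \<open>1 / n!\<close>. What remains is the
  determinant of the successive differences of the rows of the matrix of powers of
  \<open>x\<^sub>1, \<dots>, x\<^sub>n\<^sub>+\<^sub>1\<close>. Taking differences of rows does not change a determinant, and it turns
  the column of zeroth powers into the first unit vector, so this is again a Vandermonde
  determinant, now in \<open>n + 1\<close> variables (\<open>det_power_differences\<close>).
\<close>

section \<open>Determinants of matrices given by entry functions\<close>

lemma det_mat_leibniz:
  "Determinant.det (Matrix.mat n n (\<lambda>(i, j). a i j)) =
    (\<Sum>p\<in>{p. p permutes {0..<n}}. signof p * (\<Prod>i = 0..<n. a i (p i)))"
proof -
  have "(\<Prod>i = 0..<n. Matrix.mat n n (\<lambda>(i, j). a i j) $$ (i, p i)) = (\<Prod>i = 0..<n. a i (p i))"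
    if "p permutes {0..<n}" for p
    using permutes_in_image[OF that] by (intro prod.cong) auto
  then show ?thesis
    by (subst Determinant.det_def'[of _ n]) (auto intro!: sum.cong)
qed

lemma det_mat_mult:
  fixes a b :: "nat \<Rightarrow> nat \<Rightarrow> 'a :: comm_ring_1"
  shows "Determinant.det (Matrix.mat n n (\<lambda>(i, j). \<Sum>k<n. a i k * b k j)) =
    Determinant.det (Matrix.mat n n (\<lambda>(i, j). a i j)) *
    Determinant.det (Matrix.mat n n (\<lambda>(i, j). b i j))"
proof -
  have "Matrix.mat n n (\<lambda>(i, j). \<Sum>k<n. a i k * b k j) =
      Matrix.mat n n (\<lambda>(i, j). a i j) * Matrix.mat n n (\<lambda>(i, j). b i j)"
    by (rule eq_matI) (auto simp: Matrix.scalar_prod_def atLeast0LessThan intro!: sum.cong)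
  then show ?thesis
    by (simp add: Determinant.det_mult[of _ n])
qed

lemma det_mat_lower_triangular:
  fixes a :: "nat \<Rightarrow> nat \<Rightarrow> 'a :: idom"
  assumes "\<And>i j. i < j \<Longrightarrow> j < n \<Longrightarrow> a i j = 0"
  shows "Determinant.det (Matrix.mat n n (\<lambda>(i, j). a i j)) = (\<Prod>i<n. a i i)"
  using assms
  by (subst Determinant.det_lower_triangular[of n])
     (auto simp: prod_list_diag_prod atLeast0LessThan)

lemma det_mat_upper_triangular:
  fixes a :: "nat \<Rightarrow> nat \<Rightarrow> 'a :: idom"
  assumes "\<And>i j. j < i \<Longrightarrow> i < n \<Longrightarrow> a i j = 0"
  shows "Determinant.det (Matrix.mat n n (\<lambda>(i, j). a i j)) = (\<Prod>i<n. a i i)"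
  using assms
  by (subst Determinant.det_upper_triangular[of _ n])
     (auto simp: prod_list_diag_prod atLeast0LessThan)

section \<open>The Vandermonde determinant\<close>

text \<open>
  The coefficients of the monomials in the Newton basis \<open>\<Prod>l<k. (z - a l)\<close>; they are the
  complete homogeneous symmetric polynomials of degree \<open>j - k\<close> in \<open>a 0, \<dots>, a k\<close>.
\<close>
primrec newton_coeff :: "(nat \<Rightarrow> 'a :: comm_ring_1) \<Rightarrow> nat \<Rightarrow> nat \<Rightarrow> 'a" where
  "newton_coeff a 0 k = (if k = 0 then 1 else 0)"
| "newton_coeff a (Suc j) k =
     (case k of 0 \<Rightarrow> 0 | Suc k' \<Rightarrow> newton_coeff a j k') + a k * newton_coeff a j k"

lemma newton_coeff_eq_0: "j < k \<Longrightarrow> newton_coeff a j k = 0"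
  by (induction j arbitrary: k) (auto split: nat.split)

lemma newton_coeff_diag [simp]: "newton_coeff a j j = 1"
  by (induction j) (auto simp: newton_coeff_eq_0)

text \<open>
  Multiplying the expansion of \<open>z ^ j\<close> by \<open>z\<close> and writing \<open>z = (z - a k) + a k\<close> in the
  \<open>k\<close>-th term gives the recursion that defines the coefficients.
\<close>
lemma power_eq_newton_sum:
  assumes "j < n"
  shows "z ^ j = (\<Sum>k<n. (\<Prod>l<k. z - a l) * newton_coeff a j k)"
  using assms
proof (induction j arbitrary: n)
  case 0
  then show ?case
    by (simp add: sum.delta if_distrib cong: if_cong)
next
  case (Suc j)
  then obtain m where m: "n = Suc m" "j < m"
    by (cases n) auto
  let ?N = "\<lambda>k. \<Prod>l<k. z - a l" and ?c = "newton_coeff a j"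
  have "z ^ Suc j = (\<Sum>k<m. z * (?N k * ?c k))"
    using Suc.IH[OF m(2)] by (simp add: sum_distrib_left)
  also have "\<dots> = (\<Sum>k<m. ?N (Suc k) * ?c k) + (\<Sum>k<m. ?N k * (a k * ?c k))"
    by (simp add: sum.distrib[symmetric] algebra_simps)
  also have "(\<Sum>k<m. ?N k * (a k * ?c k)) = (\<Sum>k<n. ?N k * (a k * ?c k))"
    using m by (simp add: newton_coeff_eq_0)
  also have "(\<Sum>k<m. ?N (Suc k) * ?c k) =
      (\<Sum>k<n. ?N k * (case k of 0 \<Rightarrow> 0 | Suc k' \<Rightarrow> ?c k'))"
    unfolding m(1) by (subst sum.lessThan_Suc_shift) simp
  finally show ?case
    by (simp add: sum.distrib[symmetric] distrib_left)
qed

lemma vandermonde_eq_prod_lessThan: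
  "vandermonde m t = (\<Prod>j<m. \<Prod>i<j. t (Suc j) - t (Suc i))"
proof -
  have "(\<Prod>j<m. \<Prod>i<j. t (Suc j) - t (Suc i)) =
      (\<Prod>(j, i)\<in>(SIGMA j:{..<m}. {..<j}). t (Suc j) - t (Suc i))"
    by (rule prod.Sigma) auto
  also have "\<dots> = vandermonde m t"
    unfolding vandermonde_def
    by (rule prod.reindex_bij_witness[of _ "\<lambda>(i, j). (j - 1, i - 1)" "\<lambda>(j, i). (Suc i, Suc j)"])
       auto
  finally show ?thesis ..
qed

text \<open>
  Expanding the monomials in the Newton basis at \<open>t\<^sub>1, \<dots>, t\<^sub>m\<close> factors the matrix of
  powers. The values of the Newton basis at these points form a lower triangular matrix,
  because its \<open>k\<close>-th member vanishes at the first \<open>k\<close> points, and the diagonal of that matrix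
  carries the factors of the Vandermonde product. The matrix of coefficients is
  unitriangular.
\<close>
lemma vandermonde_eq_det:
  "vandermonde m t = Determinant.det (Matrix.mat m m (\<lambda>(i, j). t (Suc i) ^ j))"
proof -
  let ?a = "\<lambda>l. t (Suc l)"
  let ?N = "\<lambda>i k. \<Prod>l<k. t (Suc i) - ?a l"
  have "Matrix.mat m m (\<lambda>(i, j). t (Suc i) ^ j) =
      Matrix.mat m m (\<lambda>(i, j). \<Sum>k<m. ?N i k * newton_coeff ?a j k)"
    by (rule eq_matI) (auto intro: power_eq_newton_sum)
  then have "Determinant.det (Matrix.mat m m (\<lambda>(i, j). t (Suc i) ^ j)) =
      Determinant.det (Matrix.mat m m (\<lambda>(i, j). ?N i j)) *
      Determinant.det (Matrix.mat m m (\<lambda>(k, j). newton_coeff ?a j k))"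
    by (simp only: det_mat_mult)
  also have "Determinant.det (Matrix.mat m m (\<lambda>(i, j). ?N i j)) = (\<Prod>i<m. ?N i i)"
    by (rule det_mat_lower_triangular) auto
  also have "Determinant.det (Matrix.mat m m (\<lambda>(k, j). newton_coeff ?a j k)) = 1"
    by (subst det_mat_upper_triangular) (auto simp: newton_coeff_eq_0)
  finally show ?thesis
    by (simp add: vandermonde_eq_prod_lessThan)
qed

text \<open>
  Row \<open>i\<close> of the matrix of powers is the first row plus the first \<open>i\<close> successive
  differences. This factors the matrix into the all-ones lower triangular matrix and the
  matrix consisting of the first row and the differences, whose zeroth column is the first
  unit vector.
\<close>
lemma det_power_differences:
  "Determinant.det (Matrix.mat n n (\<lambda>(i, j). x (Suc (Suc i)) ^ Suc j - x (Suc i) ^ Suc j)) =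
    vandermonde (Suc n) x"
proof -
  let ?d = "\<lambda>i j. x (Suc (Suc i)) ^ j - x (Suc i) ^ j"
  let ?L = "\<lambda>i k. if k \<le> i then 1 else 0 :: real"
  let ?D = "\<lambda>k j. case k of 0 \<Rightarrow> x 1 ^ j | Suc k' \<Rightarrow> ?d k' j"
  have telescope: "x (Suc i) ^ j = (\<Sum>k<Suc n. ?L i k * ?D k j)" if "i < Suc n" for i j
  proof -
    have "(\<Sum>k<Suc n. ?L i k * ?D k j) = (\<Sum>k<Suc i. ?D k j)"
      using that by (intro sum.mono_neutral_cong_right) auto
    also have "\<dots> = x 1 ^ j + (\<Sum>k<i. ?d k j)"
      by (subst sum.lessThan_Suc_shift) simp
    also have "\<dots> = x (Suc i) ^ j"
      by (subst sum_lessThan_telescope[where f = "\<lambda>k. x (Suc k) ^ j"]) simp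
    finally show ?thesis ..
  qed
  have "Matrix.mat (Suc n) (Suc n) (\<lambda>(i, j). x (Suc i) ^ j) =
      Matrix.mat (Suc n) (Suc n) (\<lambda>(i, j). \<Sum>k<Suc n. ?L i k * ?D k j)"
    by (rule eq_matI) (simp_all only: telescope index_mat dim_row_mat dim_col_mat prod.case)
  then have "vandermonde (Suc n) x =
      Determinant.det (Matrix.mat (Suc n) (Suc n) (\<lambda>(i, j). ?L i j)) *
      Determinant.det (Matrix.mat (Suc n) (Suc n) (\<lambda>(i, j). ?D i j))"
    by (simp only: vandermonde_eq_det det_mat_mult)
  also have "Determinant.det (Matrix.mat (Suc n) (Suc n) (\<lambda>(i, j). ?L i j)) = 1"
    by (subst det_mat_lower_triangular) auto
  also have "Matrix.mat (Suc n) (Suc n) (\<lambda>(i, j). ?D i j) =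
      four_block_mat (Matrix.mat 1 1 (\<lambda>_. 1)) (Matrix.mat 1 n (\<lambda>(_, j). x 1 ^ Suc j))
        (0\<^sub>m n 1) (Matrix.mat n n (\<lambda>(i, j). ?d i (Suc j)))"
    by (rule eq_matI) (auto simp: less_Suc_eq_0_disj split: nat.split)
  also have "Determinant.det \<dots> = Determinant.det (Matrix.mat n n (\<lambda>(i, j). ?d i (Suc j)))"
    by (subst det_four_block_mat_lower_left_zero_col[of _ _ n])
       (auto simp: Determinant.det_single)
  finally show ?thesis
    by simp
qed

section \<open>Integration\<close>

text \<open>
  The coefficients vary in the induction: fixing the outermost variable turns its factor
  into part of the coefficient.
\<close>
lemma interlacing_integral_sum_prod:
  assumes "finite A"
    and "\<And>p i. p \<in> A \<Longrightarrow> i \<in> {1..n} \<Longrightarrow> f p i integrable_on {x i..x (Suc i)}"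
  shows "interlacing_integral n x (\<lambda>t. \<Sum>p\<in>A. c p * (\<Prod>i = 1..n. f p i (t i))) =
    (\<Sum>p\<in>A. c p * (\<Prod>i = 1..n. integral {x i..x (Suc i)} (f p i)))"
  using assms(2)
proof (induction n arbitrary: c)
  case 0
  then show ?case by simp
next
  case (Suc n)
  let ?J = "\<lambda>p. \<Prod>i = 1..n. integral {x i..x (Suc i)} (f p i)"
  have inner: "interlacing_integral n x (\<lambda>t. \<Sum>p\<in>A. c p *
      (\<Prod>i = 1..Suc n. f p i ((t(Suc n := s)) i))) = (\<Sum>p\<in>A. (c p * f p (Suc n) s) * ?J p)" for s
  proof -
    have "(\<Prod>i = 1..Suc n. f p i ((t(Suc n := s)) i)) =
        f p (Suc n) s * (\<Prod>i = 1..n. f p i (t i))" for p t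
      by (simp add: mult.commute)
    then have "interlacing_integral n x (\<lambda>t. \<Sum>p\<in>A. c p *
        (\<Prod>i = 1..Suc n. f p i ((t(Suc n := s)) i))) =
        interlacing_integral n x (\<lambda>t. \<Sum>p\<in>A. (c p * f p (Suc n) s) * (\<Prod>i = 1..n. f p i (t i)))"
      by (simp only: mult.assoc)
    also have "\<dots> = (\<Sum>p\<in>A. (c p * f p (Suc n) s) * ?J p)"
      by (rule Suc.IH) (use Suc.prems in auto)
    finally show ?thesis .
  qed
  have "((\<lambda>s. \<Sum>p\<in>A. (c p * f p (Suc n) s) * ?J p) has_integral
      (\<Sum>p\<in>A. (c p * integral {x (Suc n)..x (Suc (Suc n))} (f p (Suc n))) * ?J p))
      {x (Suc n)..x (Suc (Suc n))}"
    using assms(1) Suc.prems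
    by (intro has_integral_sum has_integral_mult_left has_integral_mult_right integrable_integral)
       auto
  then have "interlacing_integral (Suc n) x (\<lambda>t. \<Sum>p\<in>A. c p * (\<Prod>i = 1..Suc n. f p i (t i))) =
      (\<Sum>p\<in>A. (c p * integral {x (Suc n)..x (Suc (Suc n))} (f p (Suc n))) * ?J p)"
    unfolding interlacing_integral.simps inner by (rule integral_unique)
  then show ?case
    by (simp add: mult_ac)
qed

lemma integral_power:
  fixes a b :: real
  assumes "a \<le> b"
  shows "integral {a..b} (\<lambda>s. s ^ j) = (b ^ Suc j - a ^ Suc j) / real (Suc j)"
proof -
  have "((\<lambda>s. s ^ j) has_integral b ^ Suc j / real (Suc j) - a ^ Suc j / real (Suc j)) {a..b}"
    using assms
    by (intro fundamental_theorem_of_calculus)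
       (auto intro!: derivative_eq_intros
         simp: has_real_derivative_iff_has_vector_derivative[symmetric] simp del: of_nat_Suc power_Suc)
  then show ?thesis
    by (simp only: integral_unique diff_divide_distrib)
qed

theorem corollary1:
  fixes n :: nat and x :: "nat \<Rightarrow> real"
  assumes "n \<ge> 1"
    and "strict_mono_on {1..n + 1} x"
  shows "interlacing_integral n x (vandermonde n) = 1 / fact n * vandermonde (n + 1) x"
proof -
  let ?P = "{p. p permutes {0..<n}}"
  let ?d = "\<lambda>i j. x (Suc (Suc i)) ^ Suc j - x (Suc i) ^ Suc j"
  let ?r = "\<lambda>k j. if k = j then 1 / real (Suc j) else 0"
  have mono: "x i \<le> x (Suc i)" if "i \<in> {1..n}" for i
    using strict_mono_onD[OF assms(2), of i "Suc i"] that by simp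
  \<comment> \<open>The variables are numbered from \<open>1\<close>, the rows and columns of the matrix from \<open>0\<close>.\<close>
  have shift: "(\<Prod>i = 0..<n. g (Suc i)) = (\<Prod>i = 1..n. g i)" for g :: "nat \<Rightarrow> real"
    by (rule prod.reindex_bij_witness[of _ "\<lambda>i. i - 1" Suc]) auto
  have "vandermonde n = (\<lambda>t. \<Sum>p\<in>?P. signof p * (\<Prod>i = 1..n. t i ^ p (i - 1)))"
    by (simp add: fun_eq_iff vandermonde_eq_det det_mat_leibniz shift[symmetric]
      del: One_nat_def)
  then have "interlacing_integral n x (vandermonde n) =
      (\<Sum>p\<in>?P. signof p * (\<Prod>i = 1..n. integral {x i..x (Suc i)} (\<lambda>s. s ^ p (i - 1))))"
    using interlacing_integral_sum_prod[of ?P n "\<lambda>p i s. s ^ p (i - 1)" x signof]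
    by (simp add: finite_permutations integrable_continuous_real continuous_intros)
  also have "\<dots> = (\<Sum>p\<in>?P. signof p * (\<Prod>i = 0..<n. ?d i (p i) / real (Suc (p i))))"
    by (simp add: shift[symmetric] integral_power mono
      del: power_Suc of_nat_Suc One_nat_def)
  also have "\<dots> = Determinant.det (Matrix.mat n n (\<lambda>(i, j). ?d i j / real (Suc j)))"
    by (simp only: det_mat_leibniz)
  \<comment> \<open>A diagonal right factor scales the columns.\<close>
  also have "Matrix.mat n n (\<lambda>(i, j). ?d i j / real (Suc j)) =
      Matrix.mat n n (\<lambda>(i, j). \<Sum>k<n. ?d i k * ?r k j)"
    by (rule eq_matI) (simp_all add: if_distrib cong: if_cong)
  also have "Determinant.det \<dots> = vandermonde (Suc n) x * (\<Prod>j<n. 1 / real (Suc j))"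
    by (simp only: det_mat_mult det_power_differences) (subst det_mat_lower_triangular, auto)
  also have "(\<Prod>j<n. 1 / real (Suc j)) = 1 / fact n"
    by (simp add: fact_prod_Suc prod_dividef atLeast0LessThan)
  finally show ?thesis
    by simp
qed

end
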